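(* Let $p \geq 1$ be a real number and let $E$ be a Banach lattice. The following are equivalent. (a) $E$ has the disjoint Dunford-Pettis* property of order $p$ (disjoint $DP^\ast P_p$). (b) For any Banach space $Y$ such that the closed unit ball $B_{Y^\ast}$ of $Y^\ast$ is sequentially weak* compact, every bounded linear operator $T \colon E \to Y$ is disjoint $p$-convergent. (c) Every bounded linear operator $T \colon E \to c_0$ is disjoint $p$-convergent. (d) For every disjoint weakly $p$-summable sequence $(x_n)_n$ in $E$ and every weak* null sequence $(x_n^\ast)_n$ in $E^\ast$, we have $x_n^\ast(x_n) \longrightarrow 0$.
   Context: A sequence $(x_n)_n$ in a Banach lattice is disjoint if $|x_n| \wedge |x_m| = 0$ whenever $n \neq m$. A sequence $(x_n)_n$ in a Banach space $X$ is weakly $p$-summable if $\sum_n |x^\ast(x_n)|^p < \infty$ for every $x^\ast \in X^\ast$. A subset $A$ of a Banach space $X$ is limited if every weak* null sequence in $X^\ast$ converges uniformly to zero on $A$. A Banach lattice $E$ has the disjoint Dunford-Pettis* property of order $p$ (disjoint $DP^\ast P_p$) if, for every disjoint weakly $p$-summable sequence $(x_n)_n$ in $E$, the set $\{x_n : n \in \mathbb{N}\}$ is limited. A map from a Banach lattice to a Banach space is disjoint $p$-convergent if it sends disjoint weakly $p$-summable sequences to norm null sequences. *)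

theory Defs
  imports "HOL-Analysis.Analysis" "HOL-Library.Lattice_Algebras"
begin

class banach_lattice = banach + lattice_ab_group_add_abs + ordered_real_vector +
  assumes norm_lattice_mono: "\<bar>x\<bar> \<le> \<bar>y\<bar> \<Longrightarrow> norm x \<le> norm y"

instance real :: banach_lattice
  by standard simp

definition disjoint_seq :: "(nat \<Rightarrow> 'a::banach_lattice) \<Rightarrow> bool" where
  "disjoint_seq x \<longleftrightarrow> (\<forall>n m. n \<noteq> m \<longrightarrow> inf \<bar>x n\<bar> \<bar>x m\<bar> = 0)"

definition weakly_p_summable :: "real \<Rightarrow> (nat \<Rightarrow> 'a::banach) \<Rightarrow> bool" where
  "weakly_p_summable p x \<longleftrightarrow>
     (\<forall>f :: 'a \<Rightarrow>\<^sub>L real. summable (\<lambda>n. \<bar>blinfun_apply f (x n)\<bar> powr p))"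

definition weak_star_null :: "(nat \<Rightarrow> ('a::banach \<Rightarrow>\<^sub>L real)) \<Rightarrow> bool" where
  "weak_star_null f \<longleftrightarrow> (\<forall>x. (\<lambda>n. blinfun_apply (f n) x) \<longlonglongrightarrow> 0)"

definition limited :: "'a::banach set \<Rightarrow> bool" where
  "limited A \<longleftrightarrow> (\<forall>f. weak_star_null f \<longrightarrow>
     uniform_limit A (\<lambda>n. blinfun_apply (f n)) (\<lambda>_. 0) sequentially)"

definition disjoint_DPstar :: "'a::banach_lattice itself \<Rightarrow> real \<Rightarrow> bool" where
  "disjoint_DPstar _ p \<longleftrightarrow>
     (\<forall>x :: nat \<Rightarrow> 'a. disjoint_seq x \<and> weakly_p_summable p x \<longrightarrow> limited (range x))"

text \<open>
  One cannot quantify over types inside a formula, so the target spaces of operators are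
  (real) Banach spaces whose carrier is a subset of a type. The values of the operations
  outside the carrier are irrelevant.
\<close>

record 'y normed_struct =
  ncarrier :: "'y set"
  nzero :: 'y
  nadd :: "'y \<Rightarrow> 'y \<Rightarrow> 'y"
  nscale :: "real \<Rightarrow> 'y \<Rightarrow> 'y"
  nnorm :: "'y \<Rightarrow> real"

definition ndiff :: "'y normed_struct \<Rightarrow> 'y \<Rightarrow> 'y \<Rightarrow> 'y" where
  "ndiff Y x y = nadd Y x (nscale Y (- 1) y)"

locale banach_space =
  fixes Y :: "'y normed_struct"
  assumes zero_closed: "nzero Y \<in> ncarrier Y"
    and add_closed: "\<lbrakk>x \<in> ncarrier Y; y \<in> ncarrier Y\<rbrakk> \<Longrightarrow> nadd Y x y \<in> ncarrier Y"
    and scale_closed: "x \<in> ncarrier Y \<Longrightarrow> nscale Y a x \<in> ncarrier Y"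
    and add_assoc: "\<lbrakk>x \<in> ncarrier Y; y \<in> ncarrier Y; z \<in> ncarrier Y\<rbrakk>
      \<Longrightarrow> nadd Y (nadd Y x y) z = nadd Y x (nadd Y y z)"
    and add_commute: "\<lbrakk>x \<in> ncarrier Y; y \<in> ncarrier Y\<rbrakk> \<Longrightarrow> nadd Y x y = nadd Y y x"
    and add_zero: "x \<in> ncarrier Y \<Longrightarrow> nadd Y x (nzero Y) = x"
    and add_inverse: "x \<in> ncarrier Y \<Longrightarrow> nadd Y x (nscale Y (- 1) x) = nzero Y"
    and scale_add_right: "\<lbrakk>x \<in> ncarrier Y; y \<in> ncarrier Y\<rbrakk>
      \<Longrightarrow> nscale Y a (nadd Y x y) = nadd Y (nscale Y a x) (nscale Y a y)"
    and scale_add_left: "x \<in> ncarrier Y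
      \<Longrightarrow> nscale Y (a + b) x = nadd Y (nscale Y a x) (nscale Y b x)"
    and scale_scale: "x \<in> ncarrier Y \<Longrightarrow> nscale Y a (nscale Y b x) = nscale Y (a * b) x"
    and scale_one: "x \<in> ncarrier Y \<Longrightarrow> nscale Y 1 x = x"
    and norm_nonneg: "x \<in> ncarrier Y \<Longrightarrow> 0 \<le> nnorm Y x"
    and norm_eq_zero: "x \<in> ncarrier Y \<Longrightarrow> nnorm Y x = 0 \<longleftrightarrow> x = nzero Y"
    and norm_triangle: "\<lbrakk>x \<in> ncarrier Y; y \<in> ncarrier Y\<rbrakk>
      \<Longrightarrow> nnorm Y (nadd Y x y) \<le> nnorm Y x + nnorm Y y"
    and norm_scale: "x \<in> ncarrier Y \<Longrightarrow> nnorm Y (nscale Y a x) = \<bar>a\<bar> * nnorm Y x"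
    and complete: "\<lbrakk>\<And>n. s n \<in> ncarrier Y;
        \<And>e. 0 < e \<Longrightarrow> \<exists>N. \<forall>m\<ge>N. \<forall>n\<ge>N. nnorm Y (ndiff Y (s m) (s n)) < e\<rbrakk>
      \<Longrightarrow> \<exists>l\<in>ncarrier Y. (\<lambda>n. nnorm Y (ndiff Y (s n) l)) \<longlonglongrightarrow> 0"

definition type_space :: "'a::banach normed_struct" where
  "type_space = \<lparr>ncarrier = UNIV, nzero = 0, nadd = (+), nscale = (*\<^sub>R), nnorm = norm\<rparr>"

lemma banach_space_type_space: "banach_space (type_space :: 'a::banach normed_struct)"
proof (unfold_locales, goal_cases)
  case (16 s)
  have "Cauchy s"
    using 16(2) by (simp add: Cauchy_def type_space_def ndiff_def dist_norm)
  then obtain l where "s \<longlonglongrightarrow> l"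
    using Cauchy_convergent_iff convergent_def by blast
  then have "(\<lambda>n. norm (s n - l)) \<longlonglongrightarrow> 0"
    by (simp add: LIM_zero tendsto_norm_zero)
  then show ?case
    by (auto simp: type_space_def ndiff_def)
qed (auto simp: type_space_def algebra_simps norm_triangle_ineq)

definition c0 :: "(nat \<Rightarrow> real) normed_struct" where
  "c0 = \<lparr>ncarrier = {u. u \<longlonglongrightarrow> 0}, nzero = (\<lambda>_. 0), nadd = (\<lambda>u v n. u n + v n),
         nscale = (\<lambda>a u n. a * u n), nnorm = (\<lambda>u. SUP n. \<bar>u n\<bar>)\<rparr>"

lemma c0_abs_le_norm:
  assumes "u \<in> ncarrier c0" shows "\<bar>u n\<bar> \<le> nnorm c0 u"
proof -
  have "convergent u" using assms by (auto simp: c0_def convergent_def)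
  then have "Bseq u" by (rule convergent_imp_Bseq)
  then obtain K where "\<And>n. \<bar>u n\<bar> \<le> K" by (auto simp: Bseq_def)
  then have "bdd_above (range (\<lambda>n. \<bar>u n\<bar>))" by (rule bdd_aboveI2)
  then have "\<bar>u n\<bar> \<le> (SUP n. \<bar>u n\<bar>)" by (rule cSUP_upper[OF UNIV_I])
  then show ?thesis by (simp add: c0_def)
qed

lemma c0_norm_le: "(\<And>n. \<bar>u n\<bar> \<le> B) \<Longrightarrow> nnorm c0 u \<le> B"
  by (auto simp: c0_def intro!: cSUP_least)

lemma banach_space_c0: "banach_space c0"
proof (unfold_locales, goal_cases)
  case (2 x y) then show ?case using tendsto_add[of x 0 sequentially y 0] by (simp add: c0_def)
next
  case (3 x a) then show ?case using tendsto_mult_right_zero[of x sequentially a] by (simp add: c0_def)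
next
  case (12 x) show ?case using c0_abs_le_norm[OF 12, of 0] by linarith
next
  case (13 x)
  show ?case
  proof
    assume z: "nnorm c0 x = 0"
    have "x n = 0" for n using c0_abs_le_norm[OF 13, of n] unfolding z by simp
    then have "x = (\<lambda>_. 0)" by (rule ext)
    then show "x = nzero c0" by (simp add: c0_def)
  qed (simp add: c0_def)
next
  case (14 x y)
  have "\<bar>x n + y n\<bar> \<le> nnorm c0 x + nnorm c0 y" for n
    using c0_abs_le_norm[OF 14(1), of n] c0_abs_le_norm[OF 14(2), of n] by linarith
  then have "nnorm c0 (\<lambda>n. x n + y n) \<le> nnorm c0 x + nnorm c0 y" by (rule c0_norm_le)
  then show ?case by (simp add: c0_def)
next
  case (15 x a)
  have le: "nnorm c0 (\<lambda>n. b * y n) \<le> \<bar>b\<bar> * nnorm c0 y" if "y \<in> ncarrier c0" for b y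
    using c0_abs_le_norm[OF that] by (intro c0_norm_le) (simp add: abs_mult mult_left_mono)
  have "\<bar>a\<bar> * nnorm c0 x \<le> nnorm c0 (\<lambda>n. a * x n)"
  proof (cases "a = 0")
    case False
    have "(\<lambda>n. a * x n) \<in> ncarrier c0"
      using 15 tendsto_mult_right_zero[of x sequentially a] by (simp add: c0_def)
    from le[OF this, of "inverse a"] have "nnorm c0 x \<le> inverse \<bar>a\<bar> * nnorm c0 (\<lambda>n. a * x n)"
      using False by (simp add: abs_inverse flip: mult.assoc)
    then show ?thesis using False by (simp add: field_simps)
  qed (simp add: c0_def)
  with le[OF 15, of a] have "nnorm c0 (\<lambda>n. a * x n) = \<bar>a\<bar> * nnorm c0 x" by linarith
  then show ?case by (simp add: c0_def)
next
  case (16 s)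
  have diff: "ndiff c0 u v = (\<lambda>k. u k - v k)" for u v by (simp add: c0_def ndiff_def)
  have mem: "(\<lambda>k. u k - v k) \<in> ncarrier c0" if "u \<in> ncarrier c0" "v \<in> ncarrier c0" for u v
    using that tendsto_diff[of u 0 sequentially v 0] by (simp add: c0_def)
  have "uniformly_Cauchy_on UNIV s"
    unfolding uniformly_Cauchy_on_def
  proof (intro allI impI)
    fix e :: real assume "0 < e"
    from 16(2)[OF this] obtain N where
      N: "\<And>m n. \<lbrakk>m \<ge> N; n \<ge> N\<rbrakk> \<Longrightarrow> nnorm c0 (\<lambda>k. s m k - s n k) < e"
      unfolding diff by blast
    have "dist (s m k) (s n k) < e" if "m \<ge> N" "n \<ge> N" for m n k
      using c0_abs_le_norm[OF mem[OF 16(1)[of m] 16(1)[of n]], of k] N[OF that]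
      by (simp add: dist_real_def)
    then show "\<exists>M. \<forall>x\<in>UNIV. \<forall>m\<ge>M. \<forall>n\<ge>M. dist (s m x) (s n x) < e" by blast
  qed
  then obtain l where l: "uniform_limit UNIV s l sequentially"
    using Cauchy_uniformly_convergent uniformly_convergent_on_def by blast
  have ev: "\<forall>\<^sub>F n in sequentially. (s n \<longlongrightarrow> 0) sequentially"
    using 16(1) by (simp add: c0_def)
  have "(l \<longlongrightarrow> 0) sequentially"
    by (rule swap_uniform_limit'[OF ev tendsto_const l]) simp_all
  then have lc: "l \<in> ncarrier c0" by (simp add: c0_def)
  have "(\<lambda>n. nnorm c0 (\<lambda>k. s n k - l k)) \<longlonglongrightarrow> 0"
  proof (rule LIMSEQ_I)
    fix e :: real assume "0 < e"
    then have "\<forall>\<^sub>F n in sequentially. \<forall>k. dist (s n k) (l k) < e / 2"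
      using uniform_limitD[OF l, of "e / 2"] by simp
    then obtain N where N: "\<And>n k. n \<ge> N \<Longrightarrow> \<bar>s n k - l k\<bar> < e / 2"
      by (auto simp: eventually_sequentially dist_real_def)
    have "norm (nnorm c0 (\<lambda>k. s n k - l k) - 0) < e" if "n \<ge> N" for n
    proof -
      have "nnorm c0 (\<lambda>k. s n k - l k) \<le> e / 2"
        using N[OF that] by (intro c0_norm_le) (simp add: less_imp_le)
      moreover have "0 \<le> nnorm c0 (\<lambda>k. s n k - l k)"
        using c0_abs_le_norm[OF mem[OF 16(1)[of n] lc], of 0] by linarith
      ultimately show ?thesis using \<open>0 < e\<close> by simp
    qed
    then show "\<exists>N. \<forall>n\<ge>N. norm (nnorm c0 (\<lambda>k. s n k - l k) - 0) < e" by blast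
  qed
  with lc show ?case unfolding diff by blast
qed (auto simp: c0_def algebra_simps)

definition bounded_operator :: "'y normed_struct \<Rightarrow> ('a::banach \<Rightarrow> 'y) \<Rightarrow> bool" where
  "bounded_operator Y T \<longleftrightarrow>
     (\<forall>x. T x \<in> ncarrier Y) \<and>
     (\<forall>x y. T (x + y) = nadd Y (T x) (T y)) \<and>
     (\<forall>a x. T (a *\<^sub>R x) = nscale Y a (T x)) \<and>
     (\<exists>K. \<forall>x. nnorm Y (T x) \<le> K * norm x)"

text \<open>
  Functionals on \<open>Y\<close> are represented by functions on the whole type, of which only the values
  on the carrier matter. The bound below says that the dual norm is at most 1.
\<close>

definition dual_unit_ball :: "'y normed_struct \<Rightarrow> ('y \<Rightarrow> real) set" where
  "dual_unit_ball Y = {f.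
     (\<forall>x\<in>ncarrier Y. \<forall>y\<in>ncarrier Y. f (nadd Y x y) = f x + f y) \<and>
     (\<forall>a. \<forall>x\<in>ncarrier Y. f (nscale Y a x) = a * f x) \<and>
     (\<forall>x\<in>ncarrier Y. \<bar>f x\<bar> \<le> nnorm Y x)}"

definition dual_ball_seq_weak_star_compact :: "'y normed_struct \<Rightarrow> bool" where
  "dual_ball_seq_weak_star_compact Y \<longleftrightarrow>
     (\<forall>f :: nat \<Rightarrow> 'y \<Rightarrow> real. (\<forall>n. f n \<in> dual_unit_ball Y) \<longrightarrow>
        (\<exists>g\<in>dual_unit_ball Y. \<exists>r. strict_mono r \<and>
           (\<forall>y\<in>ncarrier Y. (\<lambda>n. f (r n) y) \<longlonglongrightarrow> g y)))"

definition disjoint_p_convergent ::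
    "real \<Rightarrow> 'y normed_struct \<Rightarrow> ('a::banach_lattice \<Rightarrow> 'y) \<Rightarrow> bool" where
  "disjoint_p_convergent p Y T \<longleftrightarrow>
     (\<forall>x. disjoint_seq x \<and> weakly_p_summable p x \<longrightarrow> (\<lambda>n. nnorm Y (T (x n))) \<longlonglongrightarrow> 0)"

text \<open>
  The types from which carriers of ``all Banach spaces'' are taken. With \<open>'y\<close> arbitrary, every
  Banach space is carried by some such type; the sequence summand only guarantees that
  no choice of \<open>'y\<close> is too small (every nonzero Banach space has at least the cardinality
  of the real sequences).
\<close>

type_synonym 'y universe = "'y + (nat \<Rightarrow> real)"

end

theory Submission
  imports Defs "HOL-Complex_Analysis.Great_Picard"
begin

text \<open>
  Condition (d) is the pivot: it says that weak* null sequences and disjoint weakly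
  \<open>p\<close>-summable sequences tend to zero along the diagonal. Two facts make it flexible: both
  kinds of sequences are stable under passing to subsequences, and a weakly \<open>p\<close>-summable sequence
  is weakly null.

  \<^item> (a) and (d). Uniform convergence on the range of \<open>(x\<^sub>n)\<close> includes convergence along the
    diagonal. Conversely, if \<open>(f\<^sub>k)\<close> is weak* null but not uniformly small on the range, there are
    arbitrarily late \<open>k\<close> and some \<open>n\<close> with \<open>\<bar>f\<^sub>k(x\<^sub>n)\<bar> \<ge> e\<close>. Since \<open>f\<^sub>k \<rightarrow> 0\<close> at each of finitely many
    points, the \<open>n\<close> occurring are also arbitrarily late, so strictly increasing indices can be
    picked in both sequences, and the resulting subsequences contradict (d)
    (\<open>diagonal_imp_DPstar\<close>).

  \<^item> (d) implies (b). Choose functionals \<open>g\<^sub>n\<close> in the dual ball of \<open>Y\<close> with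
    \<open>g\<^sub>n(T x\<^sub>n) = \<parallel>T x\<^sub>n\<parallel>\<close> (\<open>norming_functional\<close>, the Hahn-Banach theorem). Along a subsequence they
    have a weak* limit \<open>h\<close>, so the functionals \<open>(g\<^sub>n - h) \<circ> T\<close> are weak* null on \<open>E\<close> and
    (d) gives \<open>(g\<^sub>n - h)(T x\<^sub>n) \<rightarrow> 0\<close>. Also \<open>h(T x\<^sub>n) \<rightarrow> 0\<close>, because \<open>(x\<^sub>n)\<close> is weakly null. Hence
    \<open>\<parallel>T x\<^sub>n\<parallel> \<rightarrow> 0\<close> along that subsequence (\<open>diagonal_imp_disjoint_p_convergent\<close>).

  \<^item> (b) implies (c). The dual ball of \<open>c\<^sub>0\<close> is sequentially weak* compact, because \<open>c\<^sub>0\<close> is separable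
    (\<open>dual_ball_compact_c0\<close>). The spaces in (b) live on a sum type, so (b) is applied to
    an isometric copy of \<open>c\<^sub>0\<close> in that type.

  \<^item> (c) implies (d). A weak* null sequence \<open>(f\<^sub>n)\<close> is bounded (\<open>uniform_boundedness\<close>), so
    \<open>T z = (f\<^sub>n(z))\<^sub>n\<close> is a bounded operator into \<open>c\<^sub>0\<close>, and
    \<open>\<bar>f\<^sub>n(x\<^sub>n)\<bar> \<le> \<parallel>T x\<^sub>n\<parallel>\<close> (\<open>c0_convergent_imp_diagonal\<close>).
\<close>

section \<open>Subsequences\<close>

lemma tendsto_zero_if_subseqs:
  fixes a :: "nat \<Rightarrow> real"
  assumes "\<And>r :: nat \<Rightarrow> nat. strict_mono r \<Longrightarrow>
    \<exists>s :: nat \<Rightarrow> nat. strict_mono s \<and> (\<lambda>n. a (r (s n))) \<longlonglongrightarrow> 0"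
  shows "a \<longlonglongrightarrow> 0"
proof (rule ccontr)
  assume "\<not> a \<longlonglongrightarrow> 0"
  then obtain e where e: "e > 0" and "\<And>N. \<exists>n\<ge>N. e \<le> \<bar>a n\<bar>"
    by (auto simp: LIMSEQ_def not_less)
  then have "infinite {n. e \<le> \<bar>a n\<bar>}"
    by (auto simp: infinite_nat_iff_unbounded_le)
  then obtain r :: "nat \<Rightarrow> nat" where r: "strict_mono r" "\<And>n. e \<le> \<bar>a (r n)\<bar>"
    using infinite_enumerate by blast
  obtain s where "(\<lambda>n. a (r (s n))) \<longlonglongrightarrow> 0"
    using assms[OF r(1)] by blast
  from order_tendstoD(2)[OF tendsto_rabs_zero[OF this] e] obtain n where "\<bar>a (r (s n))\<bar> < e"
    by (auto simp: eventually_sequentially)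
  with r(2)[of "s n"] show False by simp
qed

lemma disjoint_seq_subseq:
  assumes "disjoint_seq x" "strict_mono r"
  shows "disjoint_seq (\<lambda>n. x (r n))"
  using assms by (auto simp: disjoint_seq_def strict_mono_eq)

lemma weakly_p_summable_subseq:
  assumes "weakly_p_summable p x" "strict_mono r"
  shows "weakly_p_summable p (\<lambda>n. x (r n))"
  unfolding weakly_p_summable_def
proof
  fix f :: "'a \<Rightarrow>\<^sub>L real"
  have "summable ((\<lambda>n. \<bar>blinfun_apply f (x n)\<bar> powr p) \<circ> r)"
    using assms strict_mono_imp_inj_on[OF assms(2)]
    by (intro summable_reindex) (auto simp: weakly_p_summable_def)
  then show "summable (\<lambda>n. \<bar>blinfun_apply f (x (r n))\<bar> powr p)" by (simp add: o_def)
qed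

lemma weak_star_null_subseq:
  assumes "weak_star_null f" "strict_mono r"
  shows "weak_star_null (\<lambda>n. f (r n))"
  using assms LIMSEQ_subseq_LIMSEQ[of _ 0 r] by (auto simp: weak_star_null_def o_def)

text \<open>The terms of a convergent series tend to zero, and so do their \<open>1/p\<close>-th powers.\<close>

lemma weakly_p_summable_imp_weakly_null:
  fixes f :: "'a::banach \<Rightarrow>\<^sub>L real"
  assumes "weakly_p_summable p x" "p > 0"
  shows "(\<lambda>n. blinfun_apply f (x n)) \<longlonglongrightarrow> 0"
proof -
  have "(\<lambda>n. \<bar>blinfun_apply f (x n)\<bar> powr p) \<longlonglongrightarrow> 0"
    using assms(1) by (intro summable_LIMSEQ_zero) (auto simp: weakly_p_summable_def)
  then have "(\<lambda>n. (\<bar>blinfun_apply f (x n)\<bar> powr p) powr (1 / p)) \<longlonglongrightarrow> 0"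
    by (rule tendsto_zero_powrI[OF _ tendsto_const]) (use assms(2) in auto)
  then have "(\<lambda>n. \<bar>blinfun_apply f (x n)\<bar>) \<longlonglongrightarrow> 0"
    using assms(2) by (simp add: powr_powr)
  then show ?thesis by (rule tendsto_rabs_zero_cancel)
qed

section \<open>The uniform boundedness principle\<close>

text \<open>
  By the Baire category theorem, one of the closed sets \<open>F k\<close> on which all \<open>f i\<close> are bounded by
  \<open>k\<close> contains a ball. Differences of points of that ball fill a ball around the origin, where
  the bound is \<open>2k\<close>.
\<close>

lemma uniform_boundedness:
  fixes f :: "'i \<Rightarrow> 'a::banach \<Rightarrow>\<^sub>L 'b::real_normed_vector"
  assumes "\<And>x. bounded (range (\<lambda>i. blinfun_apply (f i) x))"
  shows "bounded (range f)"
proof -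
  define F where "F k = {x. \<forall>i. norm (blinfun_apply (f i) x) \<le> real k}" for k
  have closed: "closed (F k)" for k
    unfolding F_def by (intro closed_Collect_all closed_Collect_le continuous_intros)
  have "x \<in> \<Union>(range F)" for x
  proof -
    obtain B where "\<And>i. norm (blinfun_apply (f i) x) \<le> B"
      using assms[of x] by (auto simp: bounded_iff)
    moreover obtain k where "B \<le> real k" using real_arch_simple by blast
    ultimately show ?thesis by (auto simp: F_def intro: order_trans)
  qed
  then have "\<Union>(range F) = UNIV" by blast
  then obtain k where "interior (F k) \<noteq> {}"
    using Met_TC.metric_Baire_category_alt[where ?'a = 'a and \<G> = "range F"] closed
    by (fastforce simp: complete_UNIV)
  then obtain z e where "e > 0" and ball: "cball z e \<subseteq> F k"
    by (auto simp: mem_interior_cball)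
  have "norm (f i) \<le> 2 * real k / e" for i
  proof (rule norm_blinfun_bound)
    fix x
    show "norm (blinfun_apply (f i) x) \<le> 2 * real k / e * norm x"
    proof (cases "x = 0")
      case False
      (* the scaling that moves x to the boundary of the ball of radius e *)
      define c where "c = e / norm x"
      have "c > 0" using \<open>e > 0\<close> False by (simp add: c_def)
      have "z \<in> F k" "z + c *\<^sub>R x \<in> F k"
        using ball \<open>e > 0\<close> False by (auto simp: c_def dist_norm subset_iff)
      then have "norm (blinfun_apply (f i) (z + c *\<^sub>R x) - blinfun_apply (f i) z) \<le> real k + real k"
        unfolding F_def by (intro norm_triangle_le_diff add_mono) auto
      then have "c * norm (blinfun_apply (f i) x) \<le> 2 * real k"
        using \<open>c > 0\<close> by (simp add: blinfun.add_right blinfun.scaleR_right)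
      then show ?thesis using \<open>e > 0\<close> False by (simp add: c_def field_simps)
    qed simp
  qed (use \<open>e > 0\<close> in simp)
  then show ?thesis by (auto simp: bounded_iff)
qed

section \<open>Norming functionals\<close>

text \<open>
  The Hahn-Banach theorem is obtained from minimal sublinear functionals: Zorn's lemma provides
  a minimal one below any given one, and minimality forces linearity. The value at a
  chosen point is controlled by the sublinear functional with which one starts.
\<close>

context banach_space
begin

lemma scale_zero: "x \<in> ncarrier Y \<Longrightarrow> nscale Y 0 x = nzero Y"
  using scale_add_left[of x 1 "-1"] by (simp add: scale_one add_inverse)

lemma scale_of_zero: "nscale Y a (nzero Y) = nzero Y"
  using scale_scale[OF zero_closed, of a 0] by (simp add: scale_zero zero_closed)

lemma add_left_commute:
  "\<lbrakk>x \<in> ncarrier Y; y \<in> ncarrier Y; z \<in> ncarrier Y\<rbrakk>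
    \<Longrightarrow> nadd Y x (nadd Y y z) = nadd Y y (nadd Y x z)"
  by (metis add_assoc add_commute)

lemma add_cancel:
  "\<lbrakk>x \<in> ncarrier Y; y \<in> ncarrier Y\<rbrakk> \<Longrightarrow> nadd Y (nadd Y x y) (nscale Y (- 1) x) = y"
  by (metis add_assoc add_commute add_inverse add_zero scale_closed)

text \<open>
  Values off the carrier are fixed to be 0, so that the pointwise order is antisymmetric on this
  set. One inequality suffices for positive homogeneity, since \<open>a\<close> can be replaced by \<open>1/a\<close>.
\<close>

definition sublinears :: "('y \<Rightarrow> real) set" where
  "sublinears = {q.
     (\<forall>x\<in>ncarrier Y. \<forall>y\<in>ncarrier Y. q (nadd Y x y) \<le> q x + q y) \<and>
     (\<forall>a>0. \<forall>x\<in>ncarrier Y. q (nscale Y a x) \<le> a * q x) \<and>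
     (\<forall>x\<in>ncarrier Y. q x \<le> nnorm Y x) \<and>
     (\<forall>x. x \<notin> ncarrier Y \<longrightarrow> q x = 0)}"

lemma
  assumes "q \<in> sublinears"
  shows sublinear_add: "\<lbrakk>x \<in> ncarrier Y; y \<in> ncarrier Y\<rbrakk> \<Longrightarrow> q (nadd Y x y) \<le> q x + q y"
    and sublinear_scale_le: "\<lbrakk>0 < a; x \<in> ncarrier Y\<rbrakk> \<Longrightarrow> q (nscale Y a x) \<le> a * q x"
    and sublinear_le_norm: "x \<in> ncarrier Y \<Longrightarrow> q x \<le> nnorm Y x"
    and sublinear_outside: "x \<notin> ncarrier Y \<Longrightarrow> q x = 0"
  using assms by (auto simp: sublinears_def)

lemma sublinear_zero:
  assumes "q \<in> sublinears" shows "q (nzero Y) = 0"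
  using sublinear_scale_le[OF assms _ zero_closed, of 2]
    sublinear_scale_le[OF assms _ zero_closed, of "1 / 2"]
  by (simp add: scale_of_zero)

lemma sublinear_scale:
  assumes "q \<in> sublinears" "0 \<le> a" "x \<in> ncarrier Y"
  shows "q (nscale Y a x) = a * q x"
proof (cases "a = 0")
  case False
  with assms have "a > 0" by simp
  have "q (nscale Y (1 / a) (nscale Y a x)) \<le> (1 / a) * q (nscale Y a x)"
    using assms \<open>a > 0\<close> by (intro sublinear_scale_le scale_closed) auto
  then have "a * q x \<le> q (nscale Y a x)"
    using assms \<open>a > 0\<close> by (simp add: scale_scale scale_one field_simps)
  with sublinear_scale_le[OF assms(1) \<open>a > 0\<close> assms(3)] show ?thesis by simp
qed (use assms in \<open>simp add: scale_zero sublinear_zero\<close>)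

lemma sublinear_ge:
  assumes "q \<in> sublinears" "x \<in> ncarrier Y"
  shows "- q (nscale Y (- 1) x) \<le> q x"
  using sublinear_add[OF assms(1,2) scale_closed[OF assms(2)], of "-1"] assms
  by (simp add: add_inverse sublinear_zero)

lemma sublinear_ge_norm:
  assumes "q \<in> sublinears" "x \<in> ncarrier Y"
  shows "- nnorm Y x \<le> q x"
  using sublinear_ge[OF assms] sublinear_le_norm[OF assms(1) scale_closed[OF assms(2)], of "-1"]
    norm_scale[OF assms(2), of "-1"] by simp

text \<open>
  The largest sublinear functional below \<open>q\<close> whose value at \<open>-y\<close> is at most \<open>-q(y)\<close>:
  such a functional \<open>p\<close> satisfies \<open>p(x) \<le> p(x + ty) + p(-ty) \<le> q(x + ty) - t q(y)\<close>
  for all \<open>t \<ge> 0\<close>.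
\<close>

definition tilt :: "('y \<Rightarrow> real) \<Rightarrow> 'y \<Rightarrow> 'y \<Rightarrow> real" where
  "tilt q y x = (if x \<in> ncarrier Y
     then INF t\<in>{0..}. q (nadd Y x (nscale Y t y)) - t * q y else 0)"

context
  fixes q y
  assumes q: "q \<in> sublinears" and y: "y \<in> ncarrier Y"
begin

text \<open>
  The infimum is finite: \<open>t q(y) = q((x + ty) - x) \<le> q(x + ty) + q(-x)\<close> bounds every term
  from below by \<open>-q(-x)\<close>.
\<close>

lemma tilt_lower:
  assumes x: "x \<in> ncarrier Y" and "0 \<le> t"
  shows "tilt q y x \<le> q (nadd Y x (nscale Y t y)) - t * q y"
proof -
  have "- q (nscale Y (- 1) x) \<le> q (nadd Y x (nscale Y s y)) - s * q y" if "0 \<le> s" for s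
  proof -
    have "s * q y = q (nadd Y (nadd Y x (nscale Y s y)) (nscale Y (- 1) x))"
      using that x y q by (simp add: sublinear_scale add_cancel scale_closed)
    also have "\<dots> \<le> q (nadd Y x (nscale Y s y)) + q (nscale Y (- 1) x)"
      using x y q by (intro sublinear_add add_closed scale_closed)
    finally show ?thesis by simp
  qed
  then have "bdd_below ((\<lambda>t. q (nadd Y x (nscale Y t y)) - t * q y) ` {0..})"
    by (intro bdd_belowI2) auto
  then show ?thesis
    using assms unfolding tilt_def by (auto intro: cINF_lower)
qed

lemma tilt_greatest:
  assumes "x \<in> ncarrier Y"
    and "\<And>t. 0 \<le> t \<Longrightarrow> b \<le> q (nadd Y x (nscale Y t y)) - t * q y"
  shows "b \<le> tilt q y x"
  using assms unfolding tilt_def by (auto intro: cINF_greatest)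

lemma tilt_le: "tilt q y x \<le> q x"
proof (cases "x \<in> ncarrier Y")
  case True
  with tilt_lower[OF True, of 0] y show ?thesis by (simp add: scale_zero add_zero)
qed (use q in \<open>simp add: tilt_def sublinear_outside\<close>)

lemma tilt_neg: "tilt q y (nscale Y (- 1) y) \<le> - q y"
proof -
  have "nadd Y (nscale Y (- 1) y) (nscale Y 1 y) = nzero Y"
    using y by (simp add: scale_one add_commute[OF scale_closed] add_inverse)
  with tilt_lower[OF scale_closed[OF y], of 1 "-1"] q show ?thesis
    by (simp add: sublinear_zero)
qed

text \<open>
  For subadditivity, the parameters \<open>s\<close> for \<open>u\<close> and \<open>t\<close> for \<open>v\<close> combine to the parameter
  \<open>s + t\<close> for \<open>u + v\<close>; for homogeneity, \<open>t\<close> for \<open>u\<close> corresponds to \<open>at\<close> for \<open>au\<close>.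
\<close>

lemma tilt_sublinear: "tilt q y \<in> sublinears"
  unfolding sublinears_def
proof (intro CollectI conjI ballI allI impI)
  fix u v assume u: "u \<in> ncarrier Y" and v: "v \<in> ncarrier Y"
  have le: "tilt q y (nadd Y u v) \<le>
      (q (nadd Y u (nscale Y s y)) - s * q y) + (q (nadd Y v (nscale Y t y)) - t * q y)"
    if "0 \<le> s" "0 \<le> t" for s t
  proof -
    have "tilt q y (nadd Y u v) \<le> q (nadd Y (nadd Y u v) (nscale Y (s + t) y)) - (s + t) * q y"
      using that u v by (intro tilt_lower add_closed) auto
    also have "nadd Y (nadd Y u v) (nscale Y (s + t) y) =
        nadd Y (nadd Y u (nscale Y s y)) (nadd Y v (nscale Y t y))"
      using u v y by (simp add: scale_add_left add_assoc add_left_commute add_closed scale_closed)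
    also have "q \<dots> \<le> q (nadd Y u (nscale Y s y)) + q (nadd Y v (nscale Y t y))"
      using u v y q by (intro sublinear_add add_closed scale_closed)
    finally show ?thesis by (simp add: algebra_simps)
  qed
  have "tilt q y (nadd Y u v) - (q (nadd Y u (nscale Y s y)) - s * q y) \<le> tilt q y v"
    if "0 \<le> s" for s
    using le[OF that] v by (intro tilt_greatest) (simp_all only: diff_le_eq add.commute)
  then have "tilt q y (nadd Y u v) - tilt q y v \<le> q (nadd Y u (nscale Y s y)) - s * q y"
    if "0 \<le> s" for s
    using that by (smt (verit))
  then have "tilt q y (nadd Y u v) - tilt q y v \<le> tilt q y u"
    using u by (intro tilt_greatest)
  then show "tilt q y (nadd Y u v) \<le> tilt q y u + tilt q y v" by simp
next
  fix a :: real and u assume a: "0 < a" and u: "u \<in> ncarrier Y"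
  have "tilt q y (nscale Y a u) / a \<le> tilt q y u"
  proof (rule tilt_greatest[OF u])
    fix t :: real assume t: "0 \<le> t"
    have "tilt q y (nscale Y a u) \<le>
        q (nadd Y (nscale Y a u) (nscale Y (a * t) y)) - a * t * q y"
      using a t u by (intro tilt_lower scale_closed) auto
    also have "nadd Y (nscale Y a u) (nscale Y (a * t) y) =
        nscale Y a (nadd Y u (nscale Y t y))"
      using u y by (simp add: scale_add_right scale_scale scale_closed)
    also have "q \<dots> = a * q (nadd Y u (nscale Y t y))"
      using a u y q by (intro sublinear_scale add_closed scale_closed) auto
    finally show "tilt q y (nscale Y a u) / a \<le> q (nadd Y u (nscale Y t y)) - t * q y"
      using a by (simp add: field_simps)
  qed
  then show "tilt q y (nscale Y a u) \<le> a * tilt q y u"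
    using a by (simp add: field_simps)
next
  fix u assume "u \<in> ncarrier Y"
  then show "tilt q y u \<le> nnorm Y u"
    using order_trans[OF tilt_le sublinear_le_norm[OF q]] by blast
qed (simp add: tilt_def)

end

text \<open>
  Zorn's lemma for the reversed pointwise order. The lower bound of a nonempty chain is the
  pointwise infimum, which is finite because every member is at least the negative norm.
\<close>

lemma minimal_sublinear_exists:
  assumes "q0 \<in> sublinears"
  obtains m where "m \<in> sublinears" "\<And>x. m x \<le> q0 x"
    and "\<And>q. \<lbrakk>q \<in> sublinears; \<And>x. q x \<le> m x\<rbrakk> \<Longrightarrow> q = m"
proof -
  define A where "A = {q \<in> sublinears. \<forall>x. q x \<le> q0 x}"
  define P where "P q r \<longleftrightarrow> (\<forall>x. r x \<le> q x)" for q r :: "'y \<Rightarrow> real"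
  have "\<exists>m\<in>A. \<forall>q\<in>A. P m q \<longrightarrow> q = m"
  proof (rule predicate_Zorn)
    show "partial_order_on A (relation_of P A)"
      by (rule partial_order_on_relation_ofI)
        (auto simp: P_def fun_eq_iff intro: order_trans antisym)
  next
    fix C assume C: "C \<in> Chains (relation_of P A)"
    show "\<exists>u\<in>A. \<forall>q\<in>C. P q u"
    proof (cases "C = {}")
      case True
      with assms show ?thesis by (auto simp: A_def)
    next
      case False
      have CA: "q \<in> A" if "q \<in> C" for q
        using C that by (auto simp: Chains_def relation_of_def)
      have total: "(\<forall>x. q x \<le> r x) \<or> (\<forall>x. r x \<le> q x)" if "q \<in> C" "r \<in> C" for q r
        using C that by (auto simp: Chains_def relation_of_def P_def)
      have sub: "q \<in> sublinears" if "q \<in> C" for q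
        using CA[OF that] by (simp add: A_def)
      define u where "u x = (INF q\<in>C. q x)" for x
      have bdd: "bdd_below ((\<lambda>q. q x) ` C)" for x
      proof (cases "x \<in> ncarrier Y")
        case True
        then show ?thesis
          using sublinear_ge_norm sub by (intro bdd_belowI2[where m = "- nnorm Y x"]) auto
      next
        case False
        then show ?thesis
          using sublinear_outside sub by (intro bdd_belowI2[where m = 0]) fastforce
      qed
      have lower: "u x \<le> q x" if "q \<in> C" for q x
        unfolding u_def using bdd that by (rule cINF_lower)
      have greatest: "b \<le> u x" if "\<And>q. q \<in> C \<Longrightarrow> b \<le> q x" for b x
        unfolding u_def using False that by (rule cINF_greatest)
      obtain q1 where q1: "q1 \<in> C" using False by blast
      have "u \<in> sublinears"
        unfolding sublinears_def
      proof (intro CollectI conjI ballI allI impI)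
        fix x y assume x: "x \<in> ncarrier Y" and y: "y \<in> ncarrier Y"
        have le: "u (nadd Y x y) \<le> q x + r y" if qr: "q \<in> C" "r \<in> C" for q r
        proof -
          (* the smaller of the two members of the chain *)
          obtain s where s: "s \<in> C" "s x \<le> q x" "s y \<le> r y"
            using total[OF qr] qr by blast
          have "u (nadd Y x y) \<le> s x + s y"
            using lower[OF s(1)] sublinear_add[OF sub[OF s(1)] x y] order_trans by blast
          with s show ?thesis by simp
        qed
        have "u (nadd Y x y) - q x \<le> u y" if "q \<in> C" for q
          using le[OF that] by (intro greatest) (simp add: algebra_simps)
        then have "u (nadd Y x y) - u y \<le> u x"
          by (intro greatest) (simp add: algebra_simps)
        then show "u (nadd Y x y) \<le> u x + u y" by simp
      next
        fix a :: real and x assume a: "0 < a" and x: "x \<in> ncarrier Y"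
        have "u (nscale Y a x) / a \<le> q x" if "q \<in> C" for q
          using order_trans[OF lower[OF that] sublinear_scale_le[OF sub[OF that] a x]] a
          by (simp add: field_simps)
        then have "u (nscale Y a x) / a \<le> u x" by (rule greatest)
        then show "u (nscale Y a x) \<le> a * u x" using a by (simp add: field_simps)
      next
        fix x assume "x \<in> ncarrier Y"
        then show "u x \<le> nnorm Y x"
          using lower[OF q1] sublinear_le_norm[OF sub[OF q1]] order_trans by blast
      next
        fix x assume "x \<notin> ncarrier Y"
        then have "(\<lambda>q. q x) ` C = {0}"
          using sublinear_outside sub q1 by force
        then show "u x = 0" by (simp add: u_def)
      qed
      moreover have "u x \<le> q0 x" for x
        using lower[OF q1, of x] CA[OF q1] unfolding A_def by (auto intro: order_trans)
      ultimately show ?thesis using lower by (auto simp: A_def P_def)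
    qed
  qed
  then obtain m where m: "m \<in> A" "\<And>q. \<lbrakk>q \<in> A; P m q\<rbrakk> \<Longrightarrow> q = m" by blast
  show thesis
  proof (rule that)
    show "m \<in> sublinears" "m x \<le> q0 x" for x using m(1) by (auto simp: A_def)
    fix q assume "q \<in> sublinears" "\<And>x. q x \<le> m x"
    with m show "q = m" by (auto simp: A_def P_def intro: order_trans)
  qed
qed

text \<open>
  Tilting along \<open>y\<close> cannot change a minimal \<open>m\<close>, hence \<open>m(-y) \<le> -m(y)\<close>. An odd sublinear
  functional is linear.
\<close>

lemma minimal_sublinear_in_dual_unit_ball:
  assumes m: "m \<in> sublinears"
    and min: "\<And>q. \<lbrakk>q \<in> sublinears; \<And>x. q x \<le> m x\<rbrakk> \<Longrightarrow> q = m"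
  shows "m \<in> dual_unit_ball Y"
proof -
  have neg: "m (nscale Y (- 1) y) = - m y" if y: "y \<in> ncarrier Y" for y
  proof -
    have "tilt m y = m"
      using tilt_sublinear[OF m y] tilt_le[OF m y] by (rule min)
    with tilt_neg[OF m y] sublinear_ge[OF m y] show ?thesis by simp
  qed
  show ?thesis
    unfolding dual_unit_ball_def
  proof (intro CollectI conjI ballI allI)
    fix x y assume x: "x \<in> ncarrier Y" and y: "y \<in> ncarrier Y"
    have "m y \<le> m (nadd Y x y) + m (nscale Y (- 1) x)"
      using sublinear_add[OF m add_closed[OF x y] scale_closed[OF x], of "-1"]
      by (simp add: add_cancel x y)
    with sublinear_add[OF m x y] neg[OF x] show "m (nadd Y x y) = m x + m y" by simp
  next
    fix a :: real and x assume x: "x \<in> ncarrier Y"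
    show "m (nscale Y a x) = a * m x"
    proof (cases "0 \<le> a")
      case False
      then have "m (nscale Y (- 1) (nscale Y (- a) x)) = - (- a * m x)"
        by (simp add: neg scale_closed x sublinear_scale[OF m])
      then show ?thesis by (simp add: scale_scale x)
    qed (simp add: sublinear_scale m x)
  next
    fix x assume x: "x \<in> ncarrier Y"
    show "\<bar>m x\<bar> \<le> nnorm Y x"
      using sublinear_le_norm[OF m x] sublinear_ge_norm[OF m x] by linarith
  qed
qed

text \<open>
  Start from the norm tilted along \<open>x\<close>. A minimal functional below it is linear, and its value at
  \<open>-x\<close> is at most \<open>-\<parallel>x\<parallel>\<close>.
\<close>

lemma norming_functional:
  assumes x: "x \<in> ncarrier Y"
  obtains f where "f \<in> dual_unit_ball Y" "f x = nnorm Y x"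
proof -
  define N where "N z = (if z \<in> ncarrier Y then nnorm Y z else 0)" for z
  have N: "N \<in> sublinears"
    by (auto simp: sublinears_def N_def add_closed scale_closed norm_triangle norm_scale)
  obtain m where m: "m \<in> sublinears" "\<And>z. m z \<le> tilt N x z"
      "\<And>q. \<lbrakk>q \<in> sublinears; \<And>z. q z \<le> m z\<rbrakk> \<Longrightarrow> q = m"
    using minimal_sublinear_exists[OF tilt_sublinear[OF N x]] by blast
  have "m (nscale Y (- 1) x) \<le> - nnorm Y x"
    using m(2)[of "nscale Y (- 1) x"] tilt_neg[OF N x] x by (simp add: N_def)
  then have "m x = nnorm Y x"
    using sublinear_ge[OF m(1) x] sublinear_le_norm[OF m(1) x] by simp
  with minimal_sublinear_in_dual_unit_ball[OF m(1,3)] show thesis by (rule that)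
qed

end

section \<open>Renaming the points of a Banach space\<close>

text \<open>
  Transport of structure along a map \<open>h\<close>, which is meant to be injective: then \<open>h\<close> is an
  isometric isomorphism onto the image.
\<close>

definition image_space :: "('x \<Rightarrow> 'y) \<Rightarrow> 'x normed_struct \<Rightarrow> 'y normed_struct" where
  "image_space h X = \<lparr>ncarrier = h ` ncarrier X, nzero = h (nzero X),
     nadd = (\<lambda>u v. h (nadd X (inv h u) (inv h v))),
     nscale = (\<lambda>a u. h (nscale X a (inv h u))), nnorm = (\<lambda>u. nnorm X (inv h u))\<rparr>"

lemma banach_space_image:
  assumes "banach_space X" "inj h"
  shows "banach_space (image_space h X)"
proof -
  interpret X: banach_space X by fact
  have inv [simp]: "inv h (h x) = x" for x using assms(2) by (rule inv_f_f)
  show ?thesis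
  proof (unfold_locales, goal_cases)
    case (16 s)
    define t where "t n = inv h (s n)" for n
    have t: "t n \<in> ncarrier X" "s n = h (t n)" for n
      using 16(1)[of n] by (auto simp: t_def image_space_def)
    have "\<exists>l\<in>ncarrier X. (\<lambda>n. nnorm X (ndiff X (t n) l)) \<longlonglongrightarrow> 0"
      by (rule X.complete[OF t(1)]) (use 16(2) in \<open>simp add: t(2) ndiff_def image_space_def\<close>)
    then show ?case by (auto simp: t(2) ndiff_def image_space_def)
  qed (auto simp: image_space_def X.zero_closed X.add_closed X.scale_closed X.add_assoc
      X.add_zero X.add_inverse X.scale_add_right X.scale_add_left X.scale_scale X.scale_one
      X.norm_nonneg X.norm_eq_zero X.norm_triangle X.norm_scale inj_eq[OF assms(2)]
      intro: X.add_commute)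
qed

lemma dual_ball_compact_image:
  assumes "dual_ball_seq_weak_star_compact X" "inj h"
  shows "dual_ball_seq_weak_star_compact (image_space h X)"
  unfolding dual_ball_seq_weak_star_compact_def
proof (intro allI impI)
  fix f :: "nat \<Rightarrow> 'b \<Rightarrow> real"
  assume f: "\<forall>n. f n \<in> dual_unit_ball (image_space h X)"
  have inv [simp]: "inv h (h x) = x" for x using assms(2) by (rule inv_f_f)
  have "\<forall>n. (\<lambda>x. f n (h x)) \<in> dual_unit_ball X"
    using f by (auto simp: dual_unit_ball_def image_space_def)
  with assms(1)[unfolded dual_ball_seq_weak_star_compact_def, rule_format, of "\<lambda>n x. f n (h x)"]
  obtain g r where g: "g \<in> dual_unit_ball X" "strict_mono r"
      "\<forall>y\<in>ncarrier X. (\<lambda>n. f (r n) (h y)) \<longlonglongrightarrow> g y"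
    by blast
  have "(\<lambda>u. g (inv h u)) \<in> dual_unit_ball (image_space h X)"
    using g(1) by (auto simp: dual_unit_ball_def image_space_def)
  moreover have "\<forall>y\<in>ncarrier (image_space h X). (\<lambda>n. f (r n) y) \<longlonglongrightarrow> g (inv h y)"
    using g(3) by (auto simp: image_space_def)
  ultimately show "\<exists>g\<in>dual_unit_ball (image_space h X). \<exists>r. strict_mono r \<and>
      (\<forall>y\<in>ncarrier (image_space h X). (\<lambda>n. f (r n) y) \<longlonglongrightarrow> g y)"
    using g(2) by (intro bexI[where x = "\<lambda>u. g (inv h u)"] exI[where x = r] conjI)
qed

lemma bounded_operator_image:
  assumes "bounded_operator X T" "inj h"
  shows "bounded_operator (image_space h X) (\<lambda>x. h (T x))"
  using assms by (auto simp: bounded_operator_def image_space_def)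

lemma disjoint_p_convergent_image:
  assumes "disjoint_p_convergent p (image_space h X) (\<lambda>x. h (T x))" "inj h"
  shows "disjoint_p_convergent p X T"
  using assms by (simp add: disjoint_p_convergent_def image_space_def)

section \<open>The dual unit ball of the space of null sequences\<close>

text \<open>
  A diagonal argument makes a sequence in the dual ball converge at every unit vector, hence at
  every finitely supported sequence. These are dense, and functionals of norm at most 1 are
  equicontinuous, so the values at any null sequence form a Cauchy sequence.
\<close>

lemma dual_ball_compact_c0: "dual_ball_seq_weak_star_compact c0"
  unfolding dual_ball_seq_weak_star_compact_def
proof (intro allI impI)
  fix f :: "nat \<Rightarrow> (nat \<Rightarrow> real) \<Rightarrow> real"
  assume f: "\<forall>n. f n \<in> dual_unit_ball c0"
  have add: "f n (\<lambda>k. u k + v k) = f n u + f n v" if "u \<longlonglongrightarrow> 0" "v \<longlonglongrightarrow> 0" for n u v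
    using f that by (auto simp: dual_unit_ball_def c0_def)
  have scale: "f n (\<lambda>k. a * u k) = a * f n u" if "u \<longlonglongrightarrow> 0" for n a u
    using f that by (auto simp: dual_unit_ball_def c0_def)
  have bound: "\<bar>f n u\<bar> \<le> B" if "u \<longlonglongrightarrow> 0" "\<And>k. \<bar>u k\<bar> \<le> B" for n u B
  proof -
    have "\<bar>f n u\<bar> \<le> nnorm c0 u" using f that by (auto simp: dual_unit_ball_def c0_def)
    also have "\<dots> \<le> B" using that(2) by (rule c0_norm_le)
    finally show ?thesis .
  qed
  define unit where "unit j k = (if k = j then 1 else 0 :: real)" for j k :: nat
  define trunc where "trunc u N k = (if k < N then u k else 0 :: real)" for u and N k :: nat
  have null: "v \<longlonglongrightarrow> 0" if "\<And>k. k \<ge> N \<Longrightarrow> v k = 0" for v :: "nat \<Rightarrow> real" and N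
    using that by (intro tendsto_eventually) (auto simp: eventually_sequentially)
  have unit_null: "unit j \<longlonglongrightarrow> 0" for j by (rule null[of "Suc j"]) (simp add: unit_def)
  have trunc_null: "trunc u N \<longlonglongrightarrow> 0" for u N by (rule null[of N]) (simp add: trunc_def)
  obtain r :: "nat \<Rightarrow> nat" where r: "strict_mono r"
    and conv_unit: "\<And>u. u \<in> range unit \<Longrightarrow> \<exists>l. (\<lambda>n. f (r n) u) \<longlonglongrightarrow> l"
  proof (rule function_convergent_subsequence[of "range unit" f 1])
    show "norm (f n u) \<le> 1" if "u \<in> range unit" for n u
      using that unit_null by (auto intro!: bound) (simp add: unit_def)
  qed (auto intro: that)
  have f_trunc: "f n (trunc u N) = (\<Sum>j<N. u j * f n (unit j))" for n u N
  proof (induction N)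
    case 0
    have "\<bar>f n (trunc u 0)\<bar> \<le> 0" by (rule bound[OF trunc_null]) (simp add: trunc_def)
    then show ?case by simp
  next
    case (Suc N)
    have "trunc u (Suc N) = (\<lambda>k. trunc u N k + u N * unit N k)"
      by (auto simp: trunc_def unit_def fun_eq_iff less_Suc_eq)
    then show ?case
      using add[OF trunc_null tendsto_mult_right_zero[OF unit_null]] Suc
      by (simp add: scale[OF unit_null])
  qed
  have conv: "convergent (\<lambda>n. f (r n) u)" if u: "u \<longlonglongrightarrow> 0" for u
  proof (rule real_Cauchy_convergent, rule CauchyI)
    fix e :: real assume e: "0 < e"
    obtain N where N: "\<And>k. k \<ge> N \<Longrightarrow> \<bar>u k\<bar> < e / 3"
      using LIMSEQ_D[OF u, of "e / 3"] e by auto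
    have close: "\<bar>f n u - f n (trunc u N)\<bar> \<le> e / 3" for n
    proof -
      define v where "v k = u k - trunc u N k" for k
      have v: "v \<longlonglongrightarrow> 0" unfolding v_def using tendsto_diff[OF u trunc_null[of u N]] by simp
      have "f n u = f n (trunc u N) + f n v"
        using add[OF trunc_null v, of n u N] by (simp add: v_def)
      moreover have "\<bar>f n v\<bar> \<le> e / 3"
      proof (rule bound[OF v])
        show "\<bar>v k\<bar> \<le> e / 3" for k using N[of k] e by (auto simp: v_def trunc_def)
      qed
      ultimately show ?thesis by simp
    qed
    have "convergent (\<lambda>n. f (r n) (trunc u N))"
      unfolding f_trunc
      using conv_unit by (intro convergent_sum convergent_mult convergent_const)
        (auto simp: convergent_def)
    then have "Cauchy (\<lambda>n. f (r n) (trunc u N))" by (rule convergent_Cauchy)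
    from CauchyD[OF this, of "e / 3"] e obtain M where
      M: "\<And>m n. \<lbrakk>m \<ge> M; n \<ge> M\<rbrakk> \<Longrightarrow> \<bar>f (r m) (trunc u N) - f (r n) (trunc u N)\<bar> < e / 3"
      by auto
    have "\<bar>f (r m) u - f (r n) u\<bar> < e" if "m \<ge> M" "n \<ge> M" for m n
      using M[OF that] close[of "r m"] close[of "r n"] by linarith
    then show "\<exists>M. \<forall>m\<ge>M. \<forall>n\<ge>M. norm (f (r m) u - f (r n) u) < e" by auto
  qed
  define g where "g u = lim (\<lambda>n. f (r n) u)" for u
  have lim: "(\<lambda>n. f (r n) u) \<longlonglongrightarrow> g u" if "u \<longlonglongrightarrow> 0" for u
    using conv[OF that] by (simp add: g_def convergent_LIMSEQ_iff)
  have "g \<in> dual_unit_ball c0"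
    unfolding dual_unit_ball_def
  proof (intro CollectI conjI ballI allI)
    fix u v assume "u \<in> ncarrier c0" "v \<in> ncarrier c0"
    then have u: "u \<longlonglongrightarrow> 0" and v: "v \<longlonglongrightarrow> 0" by (auto simp: c0_def)
    have "(\<lambda>n. f (r n) (\<lambda>k. u k + v k)) \<longlonglongrightarrow> g u + g v"
      unfolding add[OF u v] by (intro tendsto_add lim u v)
    from LIMSEQ_unique[OF lim this] tendsto_add[OF u v]
    show "g (nadd c0 u v) = g u + g v" by (simp add: c0_def)
  next
    fix a :: real and u assume "u \<in> ncarrier c0"
    then have u: "u \<longlonglongrightarrow> 0" by (auto simp: c0_def)
    have "(\<lambda>n. f (r n) (\<lambda>k. a * u k)) \<longlonglongrightarrow> a * g u"
      unfolding scale[OF u] by (intro tendsto_mult_left lim u)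
    from LIMSEQ_unique[OF lim this] tendsto_mult_right_zero[OF u]
    show "g (nscale c0 a u) = a * g u" by (simp add: c0_def)
  next
    fix u assume uc: "u \<in> ncarrier c0"
    then have u: "u \<longlonglongrightarrow> 0" by (auto simp: c0_def)
    show "\<bar>g u\<bar> \<le> nnorm c0 u"
      using tendsto_rabs[OF lim[OF u]] bound[OF u c0_abs_le_norm[OF uc]]
      by (intro LIMSEQ_le_const2) auto
  qed
  moreover have "\<forall>u\<in>ncarrier c0. (\<lambda>n. f (r n) u) \<longlonglongrightarrow> g u"
    using lim by (simp add: c0_def)
  ultimately show "\<exists>g\<in>dual_unit_ball c0. \<exists>r. strict_mono r \<and>
      (\<forall>u\<in>ncarrier c0. (\<lambda>n. f (r n) u) \<longlonglongrightarrow> g u)"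
    using r by blast
qed

section \<open>The four conditions\<close>

definition diagonal_condition :: "'a::banach_lattice itself \<Rightarrow> real \<Rightarrow> bool" where
  "diagonal_condition _ p \<longleftrightarrow>
     (\<forall>(x :: nat \<Rightarrow> 'a) f. disjoint_seq x \<and> weakly_p_summable p x \<and> weak_star_null f \<longrightarrow>
        (\<lambda>n. blinfun_apply (f n) (x n)) \<longlonglongrightarrow> 0)"

text \<open>
  A failure of uniformity yields pairs \<open>(k, n)\<close> with \<open>\<bar>f k (x n)\<bar> \<ge> e\<close> and \<open>k\<close> arbitrarily large;
  the work is to make \<open>n\<close> grow as well, so that the \<open>x n\<close> picked form a subsequence and are
  again disjoint.
\<close>

lemma diagonal_imp_DPstar:
  assumes "diagonal_condition TYPE('a::banach_lattice) p"
  shows "disjoint_DPstar TYPE('a) p"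
  unfolding disjoint_DPstar_def limited_def
proof (intro allI impI, elim conjE)
  fix x :: "nat \<Rightarrow> 'a" and f :: "nat \<Rightarrow> 'a \<Rightarrow>\<^sub>L real"
  assume x: "disjoint_seq x" "weakly_p_summable p x" and f: "weak_star_null f"
  show "uniform_limit (range x) (\<lambda>n. blinfun_apply (f n)) (\<lambda>_. 0) sequentially"
  proof (rule ccontr)
    assume "\<not> ?thesis"
    then obtain e where e: "e > 0"
      and far: "\<And>K. \<exists>k\<ge>K. \<exists>n. e \<le> \<bar>blinfun_apply (f k) (x n)\<bar>"
      by (auto simp: uniform_limit_sequentially_iff not_less)
    (* beyond M, the first N + 1 points no longer witness the failure of uniformity *)
    have ex: "\<exists>k>K. \<exists>n>N. e \<le> \<bar>blinfun_apply (f k) (x n)\<bar>" for K N :: nat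
    proof -
      have "\<forall>\<^sub>F k in sequentially. \<forall>n\<in>{..N}. \<bar>blinfun_apply (f k) (x n)\<bar> < e"
        using f e by (intro eventually_ball_finite ballI order_tendstoD(2)[OF tendsto_rabs_zero])
          (auto simp: weak_star_null_def)
      then obtain M where
        M: "\<And>k n. \<lbrakk>k \<ge> M; n \<le> N\<rbrakk> \<Longrightarrow> \<bar>blinfun_apply (f k) (x n)\<bar> < e"
        by (auto simp: eventually_sequentially)
      obtain k n where kn: "k \<ge> max M (Suc K)" "e \<le> \<bar>blinfun_apply (f k) (x n)\<bar>"
        using far by blast
      then have "n > N" using M[of k n] by (cases "n \<le> N") auto
      with kn show ?thesis by (auto simp: Suc_le_eq)
    qed
    define P where "P z \<longleftrightarrow> e \<le> \<bar>blinfun_apply (f (fst z)) (x (snd z))\<bar>" for z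
    have step: "\<exists>z. P z \<and> (fst w < fst z \<and> snd w < snd z)" for w
      using ex[of "fst w" "snd w"] unfolding P_def by (metis fst_conv snd_conv)
    have "\<exists>q. \<forall>i. P (q i) \<and> (fst (q i) < fst (q (Suc i)) \<and> snd (q i) < snd (q (Suc i)))"
      by (rule dependent_nat_choice) (use step in blast)+
    then obtain q :: "nat \<Rightarrow> nat \<times> nat" where
      q: "\<And>i. e \<le> \<bar>blinfun_apply (f (fst (q i))) (x (snd (q i)))\<bar>"
        "strict_mono (\<lambda>i. fst (q i))" "strict_mono (\<lambda>i. snd (q i))"
      by (auto simp: P_def strict_mono_Suc_iff)
    have "(\<lambda>i. blinfun_apply (f (fst (q i))) (x (snd (q i)))) \<longlonglongrightarrow> 0"
      using assms[unfolded diagonal_condition_def, rule_format,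
          of "\<lambda>i. x (snd (q i))" "\<lambda>i. f (fst (q i))"]
        disjoint_seq_subseq[OF x(1) q(3)] weakly_p_summable_subseq[OF x(2) q(3)]
        weak_star_null_subseq[OF f q(2)] by blast
    from order_tendstoD(2)[OF tendsto_rabs_zero[OF this] e] q(1) show False
      by (auto simp: eventually_sequentially not_less[symmetric])
  qed
qed

lemma DPstar_imp_diagonal:
  assumes "disjoint_DPstar TYPE('a::banach_lattice) p"
  shows "diagonal_condition TYPE('a) p"
  unfolding diagonal_condition_def
proof (intro allI impI, elim conjE)
  fix x :: "nat \<Rightarrow> 'a" and f :: "nat \<Rightarrow> 'a \<Rightarrow>\<^sub>L real"
  assume "disjoint_seq x" "weakly_p_summable p x" "weak_star_null f"
  with assms have lim: "uniform_limit (range x) (\<lambda>n. blinfun_apply (f n)) (\<lambda>_. 0) sequentially"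
    by (auto simp: disjoint_DPstar_def limited_def)
  show "(\<lambda>n. blinfun_apply (f n) (x n)) \<longlonglongrightarrow> 0"
  proof (rule tendstoI)
    fix e :: real assume "0 < e"
    from uniform_limitD[OF lim this]
    show "\<forall>\<^sub>F n in sequentially. dist (blinfun_apply (f n) (x n)) 0 < e"
      by (rule eventually_mono) auto
  qed
qed

lemma bounded_linear_dual_comp:
  assumes T: "bounded_operator Y T" and g: "g \<in> dual_unit_ball Y"
  shows "bounded_linear (\<lambda>x. g (T x))"
proof -
  obtain K where K: "\<And>x. nnorm Y (T x) \<le> K * norm x"
    using T by (auto simp: bounded_operator_def)
  show ?thesis
  proof (rule bounded_linear_intro)
    show "norm (g (T x)) \<le> norm x * K" for x
    proof -
      have "norm (g (T x)) \<le> nnorm Y (T x)"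
        using T g by (auto simp: bounded_operator_def dual_unit_ball_def)
      with K[of x] show ?thesis by (simp add: mult.commute)
    qed
  qed (use T g in \<open>auto simp: bounded_operator_def dual_unit_ball_def\<close>)
qed

text \<open>
  Every subsequence of \<open>(T x\<^sub>n)\<close> has a further norm null subsequence. It is the one along which
  norming functionals converge weak* to some \<open>h\<close>: both \<open>(g\<^sub>n - h)(T x\<^sub>n)\<close> and \<open>h(T x\<^sub>n)\<close> tend to 0.
\<close>

lemma diagonal_imp_disjoint_p_convergent:
  fixes T :: "'a::banach_lattice \<Rightarrow> 'y"
  assumes diag: "diagonal_condition TYPE('a) p" and "p > 0"
    and Y: "banach_space Y" "dual_ball_seq_weak_star_compact Y"
    and T: "bounded_operator Y T"
  shows "disjoint_p_convergent p Y T"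
  unfolding disjoint_p_convergent_def
proof (intro allI impI, elim conjE, rule tendsto_zero_if_subseqs)
  fix x :: "nat \<Rightarrow> 'a" and r :: "nat \<Rightarrow> nat"
  assume x: "disjoint_seq x" "weakly_p_summable p x" and r: "strict_mono r"
  have Tc: "T z \<in> ncarrier Y" for z using T by (simp add: bounded_operator_def)
  have "\<exists>g. g \<in> dual_unit_ball Y \<and> g (T (x (r n))) = nnorm Y (T (x (r n)))" for n
    using banach_space.norming_functional[OF Y(1) Tc] by metis
  then obtain g where g: "\<And>n. g n \<in> dual_unit_ball Y"
      "\<And>n. g n (T (x (r n))) = nnorm Y (T (x (r n)))"
    by metis
  from Y(2)[unfolded dual_ball_seq_weak_star_compact_def, rule_format, of g, OF g(1)]
  obtain h s where h: "h \<in> dual_unit_ball Y" and s: "strict_mono s"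
    and lim: "\<And>y. y \<in> ncarrier Y \<Longrightarrow> (\<lambda>n. g (s n) y) \<longlonglongrightarrow> h y"
    by blast
  define F where "F n = Blinfun (\<lambda>z. g (s n) (T z)) - Blinfun (\<lambda>z. h (T z))" for n
  have apply_F: "blinfun_apply (F n) z = g (s n) (T z) - h (T z)" for n z
    using g(1) h by (simp add: F_def blinfun.diff_left bounded_linear_Blinfun_apply
        bounded_linear_dual_comp[OF T])
  have rs: "strict_mono (\<lambda>n. r (s n))" using strict_mono_o[OF r s] by (simp add: o_def)
  have "weak_star_null F"
    unfolding weak_star_null_def apply_F using lim[OF Tc] by (simp add: LIM_zero)
  then have F0: "(\<lambda>n. blinfun_apply (F n) (x (r (s n)))) \<longlonglongrightarrow> 0"
    using diag disjoint_seq_subseq[OF x(1) rs] weakly_p_summable_subseq[OF x(2) rs]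
    unfolding diagonal_condition_def by blast
  have h0: "(\<lambda>n. h (T (x (r (s n))))) \<longlonglongrightarrow> 0"
    using weakly_p_summable_imp_weakly_null[OF weakly_p_summable_subseq[OF x(2) rs] \<open>p > 0\<close>,
        of "Blinfun (\<lambda>z. h (T z))"]
    by (simp add: bounded_linear_Blinfun_apply bounded_linear_dual_comp[OF T h])
  have "(\<lambda>n. nnorm Y (T (x (r (s n))))) \<longlonglongrightarrow> 0"
    using tendsto_add[OF F0 h0] by (simp add: apply_F g(2))
  with s show "\<exists>s :: nat \<Rightarrow> nat. strict_mono s \<and> (\<lambda>n. nnorm Y (T (x (r (s n))))) \<longlonglongrightarrow> 0"
    by blast
qed

text \<open>
  Pointwise convergence to 0 puts the values in \<open>c\<^sub>0\<close>; uniform boundedness of \<open>(f\<^sub>n)\<close> gives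
  the bound on the operator.
\<close>

lemma weak_star_null_imp_bounded_operator_c0:
  assumes "weak_star_null f"
  shows "bounded_operator c0 (\<lambda>z n. blinfun_apply (f n) z)"
proof -
  have lim: "(\<lambda>n. blinfun_apply (f n) z) \<longlonglongrightarrow> 0" for z
    using assms by (simp add: weak_star_null_def)
  have "bounded (range f)"
    using lim by (intro uniform_boundedness convergent_imp_bounded)
  then obtain K where K: "\<And>n. norm (f n) \<le> K" by (auto simp: bounded_iff)
  have "nnorm c0 (\<lambda>n. blinfun_apply (f n) z) \<le> K * norm z" for z
  proof (rule c0_norm_le)
    fix n
    have "\<bar>blinfun_apply (f n) z\<bar> \<le> norm (f n) * norm z" using norm_blinfun[of "f n" z] by simp
    also have "\<dots> \<le> K * norm z" by (intro mult_right_mono K) simp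
    finally show "\<bar>blinfun_apply (f n) z\<bar> \<le> K * norm z" .
  qed
  with lim show ?thesis
    by (auto simp: bounded_operator_def c0_def blinfun.add_right blinfun.scaleR_right)
qed

lemma c0_convergent_imp_diagonal:
  assumes "\<And>T :: 'a::banach_lattice \<Rightarrow> nat \<Rightarrow> real.
    bounded_operator c0 T \<Longrightarrow> disjoint_p_convergent p c0 T"
  shows "diagonal_condition TYPE('a) p"
  unfolding diagonal_condition_def
proof (intro allI impI, elim conjE)
  fix x :: "nat \<Rightarrow> 'a" and f :: "nat \<Rightarrow> 'a \<Rightarrow>\<^sub>L real"
  assume x: "disjoint_seq x" "weakly_p_summable p x" and f: "weak_star_null f"
  have "(\<lambda>n. nnorm c0 (\<lambda>k. blinfun_apply (f k) (x n))) \<longlonglongrightarrow> 0"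
    using assms[OF weak_star_null_imp_bounded_operator_c0[OF f]] x
    by (simp add: disjoint_p_convergent_def)
  moreover have "\<bar>blinfun_apply (f n) (x n)\<bar> \<le> nnorm c0 (\<lambda>k. blinfun_apply (f k) (x n))" for n
    using f by (intro c0_abs_le_norm[where u = "\<lambda>k. blinfun_apply (f k) (x n)"])
      (simp add: c0_def weak_star_null_def)
  ultimately show "(\<lambda>n. blinfun_apply (f n) (x n)) \<longlonglongrightarrow> 0"
    by (intro Lim_null_comparison[where f = "\<lambda>n. blinfun_apply (f n) (x n)"]) auto
qed

theorem theorem3p3:
  fixes p :: real
    and E :: "'a::banach_lattice itself"
  assumes "p \<ge> 1"
  defines "a \<equiv> disjoint_DPstar E p"
    and "b \<equiv> (\<forall>Y :: 'y universe normed_struct.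
                 banach_space Y \<and> dual_ball_seq_weak_star_compact Y \<longrightarrow>
                 (\<forall>T :: 'a \<Rightarrow> 'y universe. bounded_operator Y T \<longrightarrow> disjoint_p_convergent p Y T))"
    and "c \<equiv> (\<forall>T :: 'a \<Rightarrow> nat \<Rightarrow> real. bounded_operator c0 T \<longrightarrow> disjoint_p_convergent p c0 T)"
    and "d \<equiv> (\<forall>(x :: nat \<Rightarrow> 'a) f. disjoint_seq x \<and> weakly_p_summable p x \<and> weak_star_null f \<longrightarrow>
                 (\<lambda>n. blinfun_apply (f n) (x n)) \<longlonglongrightarrow> 0)"
  shows "(a \<longleftrightarrow> b) \<and> (b \<longleftrightarrow> c) \<and> (c \<longleftrightarrow> d)"
proof -
  have d: "d \<longleftrightarrow> diagonal_condition TYPE('a) p"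
    by (simp add: d_def diagonal_condition_def)
  have "a \<longleftrightarrow> disjoint_DPstar TYPE('a) p"
    by (simp add: a_def disjoint_DPstar_def)
  then have "a \<longleftrightarrow> d"
    unfolding d using diagonal_imp_DPstar DPstar_imp_diagonal by blast
  moreover have "d \<Longrightarrow> b"
    unfolding d b_def using assms(1) by (intro allI impI diagonal_imp_disjoint_p_convergent) auto
  moreover have c if b
    unfolding c_def
  proof (intro allI impI)
    fix T :: "'a \<Rightarrow> nat \<Rightarrow> real" assume T: "bounded_operator c0 T"
    let ?h = "Inr :: _ \<Rightarrow> 'y universe"
    have h: "inj ?h" by simp
    have "disjoint_p_convergent p (image_space ?h c0) (\<lambda>x. ?h (T x))"
      using \<open>b\<close>[unfolded b_def, rule_format, of "image_space ?h c0" "\<lambda>x. ?h (T x)"]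
        banach_space_image[OF banach_space_c0 h] dual_ball_compact_image[OF dual_ball_compact_c0 h]
        bounded_operator_image[OF T h]
      by simp
    then show "disjoint_p_convergent p c0 T" using h by (rule disjoint_p_convergent_image)
  qed
  moreover have "c \<Longrightarrow> d"
    unfolding c_def d using c0_convergent_imp_diagonal by blast
  ultimately show ?thesis by blast
qed

end
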